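(* Let $V$ be a finite set of cardinality $v$ and let $D_1,D_2$ be block designs built on $V$ with parameters $(v,b_i,r_i,k_i,\lambda_i)$, $i=1,2$, with blocks listed as $B_1^1,\dots,B_1^{b_1}$ and $B_2^1,\dots,B_2^{b_2}$. Let $M$ be the $b_1\times b_2$ matrix with entries $M_{ij}=|B_1^i\cap B_2^j|$. Then every diagonal entry of $MM^T$ equals $$(MM^T)_{nn}=k_1(\lambda_2k_1-\lambda_2+r_2),\qquad n=1,\dots,b_1.$$
   Context: A (balanced incomplete) block design with parameters $(v,b,r,k,\lambda)$ built on a finite set $V$ with $|V|=v$ is a list (repetitions allowed) of $b$ blocks, each a $k$-element subset of $V$ with $k<v$, such that every element of $V$ lies in exactly $r$ blocks and every pair of distinct elements of $V$ lies in exactly $\lambda$ blocks; here $b,r,k,\lambda$ are positive integers, except that the paper also regards the design whose blocks are the $v$ one-element subsets of $V$ (parameters $b=v$, $r=k=1$, $\lambda=0$) as a block design. The matrix $M$ is called the mutual incidence matrix of $D_1$ and $D_2$. *)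

theory Defs
  imports "Jordan_Normal_Form.Matrix"
begin

definition proper_block_design ::
    "'a set \<Rightarrow> 'a set list \<Rightarrow> nat \<Rightarrow> nat \<Rightarrow> nat \<Rightarrow> nat \<Rightarrow> nat \<Rightarrow> bool" where
  "proper_block_design V Bs v b r k l \<longleftrightarrow>
     finite V \<and> card V = v \<and> length Bs = b \<and>
     0 < b \<and> 0 < r \<and> 0 < k \<and> 0 < l \<and> k < v \<and>
     (\<forall>B \<in> set Bs. B \<subseteq> V \<and> card B = k) \<and>
     (\<forall>x \<in> V. length (filter (\<lambda>B. x \<in> B) Bs) = r) \<and>
     (\<forall>x \<in> V. \<forall>y \<in> V. x \<noteq> y \<longrightarrow> length (filter (\<lambda>B. x \<in> B \<and> y \<in> B) Bs) = l)"

definition singleton_block_design ::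
    "'a set \<Rightarrow> 'a set list \<Rightarrow> nat \<Rightarrow> nat \<Rightarrow> nat \<Rightarrow> nat \<Rightarrow> nat \<Rightarrow> bool" where
  "singleton_block_design V Bs v b r k l \<longleftrightarrow>
     finite V \<and> card V = v \<and> length Bs = b \<and>
     b = v \<and> r = 1 \<and> k = 1 \<and> l = 0 \<and>
     distinct Bs \<and> set Bs = (\<lambda>x. {x}) ` V"

definition block_design ::
    "'a set \<Rightarrow> 'a set list \<Rightarrow> nat \<Rightarrow> nat \<Rightarrow> nat \<Rightarrow> nat \<Rightarrow> nat \<Rightarrow> bool" where
  "block_design V Bs v b r k l \<longleftrightarrow>
     proper_block_design V Bs v b r k l \<or> singleton_block_design V Bs v b r k l"

text \<open>Entries are integers, so that subtraction in entry formulas is not truncated;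
  rows and columns are indexed from 0.\<close>

definition mutual_incidence_matrix :: "'a set list \<Rightarrow> 'a set list \<Rightarrow> int mat" where
  "mutual_incidence_matrix Bs Cs =
     mat (length Bs) (length Cs) (\<lambda>(i, j). int (card (Bs ! i \<inter> Cs ! j)))"

end

theory Submission
  imports Defs
begin

text \<open>Double counting: \<open>(M M\<^sup>T)\<^sub>n\<^sub>n\<close> counts the triples \<open>(x, y, j)\<close> with \<open>x\<close> and \<open>y\<close> in the \<open>n\<close>-th
  block of the first design and both in the \<open>j\<close>-th block of the second. The \<open>k\<^sub>1\<close> diagonal pairs
  contribute \<open>r\<^sub>2\<close> each and the \<open>k\<^sub>1 (k\<^sub>1 - 1)\<close> off-diagonal ones contribute \<open>\<lambda>\<^sub>2\<close> each.\<close>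

text \<open>Each square expands as a double sum of indicators over \<open>A\<close>. Induction on
  the list, rather than a sum over a set of blocks, counts repeated blocks with
  multiplicity.\<close>

lemma sum_list_card_Int_squared:
  assumes "finite A"
  shows "(\<Sum>C\<leftarrow>Cs. card (A \<inter> C) * card (A \<inter> C)) =
    (\<Sum>x\<in>A. \<Sum>y\<in>A. length (filter (\<lambda>C. x \<in> C \<and> y \<in> C) Cs))"
proof (induction Cs)
  case Nil
  then show ?case by simp
next
  case (Cons C Cs)
  have card: "card (A \<inter> C) = (\<Sum>x\<in>A. of_bool (x \<in> C))"
    using assms by (simp add: Int_def)
  have "card (A \<inter> C) * card (A \<inter> C) = (\<Sum>x\<in>A. \<Sum>y\<in>A. of_bool (x \<in> C \<and> y \<in> C))"
    unfolding card sum_product by (simp add: of_bool_conj)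
  moreover have "length (filter (\<lambda>C. x \<in> C \<and> y \<in> C) (C # Cs)) =
      of_bool (x \<in> C \<and> y \<in> C) + length (filter (\<lambda>C. x \<in> C \<and> y \<in> C) Cs)" for x y
    by simp
  ultimately show ?case
    using Cons.IH by (simp only: list.map sum_list.Cons sum.distrib)
qed

lemma block_design_block:
  assumes "block_design V Bs v b r k l" and "B \<in> set Bs"
  shows "B \<subseteq> V" and "card B = k"
  using assms
  by (auto simp: block_design_def proper_block_design_def singleton_block_design_def)

lemma block_design_replication:
  assumes "block_design V Bs v b r k l" and "x \<in> V"
  shows "length (filter (\<lambda>B. x \<in> B) Bs) = r"
  using assms(1) unfolding block_design_def
proof
  assume "proper_block_design V Bs v b r k l"
  then show ?thesis using assms(2) by (simp add: proper_block_design_def)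
next
  assume *: "singleton_block_design V Bs v b r k l"
  then have "length (filter (\<lambda>B. x \<in> B) Bs) = card (set (filter (\<lambda>B. x \<in> B) Bs))"
    \<comment> \<open>Rewriting with \<open>set_filter\<close> would destroy the
      \<open>card (set _)\<close> pattern that \<open>distinct_card\<close> needs.\<close>
    by (simp add: singleton_block_design_def distinct_card del: set_filter)
  also have "set (filter (\<lambda>B. x \<in> B) Bs) = {{x}}"
    using * assms(2) by (auto simp: singleton_block_design_def)
  finally show ?thesis using * by (simp add: singleton_block_design_def)
qed

text \<open>In the singleton design no block holds two distinct points, so the filtered list is
  empty, matching \<open>l = 0\<close>.\<close>

lemma block_design_balance:
  assumes "block_design V Bs v b r k l" and "x \<in> V" and "y \<in> V" and "x \<noteq> y"
  shows "length (filter (\<lambda>B. x \<in> B \<and> y \<in> B) Bs) = l"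
  using assms
  by (auto simp: block_design_def proper_block_design_def singleton_block_design_def
      filter_empty_conv)

text \<open>For fixed \<open>x\<close> in \<open>A\<close>, the term \<open>y = x\<close> gives
  \<open>r\<close> and each of the other \<open>card A - 1\<close> points gives \<open>l\<close>.
  Any finite subset of \<open>V\<close> can serve as \<open>A\<close>; a block of another design is
  the intended case.\<close>

lemma block_design_sum_card_Int_squared:
  assumes D: "block_design V Cs v b r k l" and "finite A" and "A \<subseteq> V"
  shows "(\<Sum>C\<leftarrow>Cs. card (A \<inter> C) * card (A \<inter> C)) = card A * (r + (card A - 1) * l)"
proof -
  have "(\<Sum>y\<in>A. length (filter (\<lambda>C. x \<in> C \<and> y \<in> C) Cs)) = r + (card A - 1) * l"
    if x: "x \<in> A" for x
  proof -
    have "(\<Sum>y\<in>A - {x}. length (filter (\<lambda>C. x \<in> C \<and> y \<in> C) Cs)) = (\<Sum>y\<in>A - {x}. l)"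
      using x \<open>A \<subseteq> V\<close> by (intro sum.cong refl block_design_balance[OF D]) auto
    moreover have "length (filter (\<lambda>C. x \<in> C) Cs) = r"
      using x \<open>A \<subseteq> V\<close> by (intro block_design_replication[OF D]) auto
    ultimately show ?thesis
      using x \<open>finite A\<close> by (simp add: sum.remove[of A x] card_Diff_singleton)
  qed
  then show ?thesis
    by (simp add: sum_list_card_Int_squared[OF \<open>finite A\<close>])
qed

lemma mutual_incidence_matrix_gram_diag:
  assumes "n < length Bs"
  shows "(mutual_incidence_matrix Bs Cs * transpose_mat (mutual_incidence_matrix Bs Cs)) $$ (n, n) =
    int (\<Sum>C\<leftarrow>Cs. card (Bs ! n \<inter> C) * card (Bs ! n \<inter> C))"
  using assms
  by (simp add: mutual_incidence_matrix_def scalar_prod_def sum_list_sum_nth)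

theorem theorem1:
  fixes V :: "'a set" and Bs1 Bs2 :: "'a set list"
    and v b1 r1 k1 l1 b2 r2 k2 l2 n :: nat
    and M :: "int mat"
  assumes "finite V" and "card V = v"
    and "block_design V Bs1 v b1 r1 k1 l1"
    and "block_design V Bs2 v b2 r2 k2 l2"
    and "M = mutual_incidence_matrix Bs1 Bs2"
    and "n < b1"
  shows "(M * transpose_mat M) $$ (n, n) = int k1 * (int l2 * int k1 - int l2 + int r2)"
proof -
  have n: "n < length Bs1" and "k1 > 0"
    using assms(3,6)
    by (auto simp: block_design_def proper_block_design_def singleton_block_design_def)
  have B: "Bs1 ! n \<subseteq> V" "card (Bs1 ! n) = k1"
    using block_design_block[OF assms(3)] n by auto
  have "(M * transpose_mat M) $$ (n, n) = int (k1 * (r2 + (k1 - 1) * l2))"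
    using mutual_incidence_matrix_gram_diag[OF n]
      block_design_sum_card_Int_squared[OF assms(4) finite_subset[OF B(1) assms(1)] B(1)]
    by (simp add: assms(5) B(2))
  also have "\<dots> = int k1 * (int l2 * int k1 - int l2 + int r2)"
    using \<open>k1 > 0\<close> by (cases k1) (simp_all add: algebra_simps)
  finally show ?thesis .
qed

end
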